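(* Let $l,r\in\mathbb{N}$ satisfy $l\le r$. Then $$\sum_{i=0}^{l-1}\frac{\binom{l-1}{i}}{\binom{2r-i}{l}}=\frac{1}{2\binom{r}{l}}.$$
   Context: $\mathbb{N}=\{1,2,3,\dots\}$, and $\binom{\cdot}{\cdot}$ denotes the ordinary binomial coefficient. *)

theory Defs
  imports Complex_Main
begin

end

(* The reciprocal of binom(N, l) is l times the integral of x^(N-l) (1-x)^(l-1) over [0,1].
   Summing against binom(l-1, i) therefore produces l times the integral of
   x^(2r-2l+1) (1-x)^(l-1) (1+x)^(l-1) = x (x^2)^(r-l) (1-x^2)^(l-1),
   and substituting u = x^2 turns this into half the integral representing 1 / binom(r, l). *)
theory Submission
  imports Defs "HOL-Analysis.Analysis"
begin

text \<open>Euler's Beta integral at integer arguments. The induction on \<open>b\<close> splits one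
  factor \<open>1 - x\<close> as a difference, which raises the exponent of \<open>x\<close>; hence
  \<open>a\<close> has to stay arbitrary.\<close>

lemma has_integral_power_mult_one_minus_power:
  "((\<lambda>x::real. x ^ a * (1 - x) ^ b) has_integral (fact a * fact b / fact (a + b + 1))) {0..1}"
proof (induction b arbitrary: a)
  case 0
  have "((\<lambda>x::real. x ^ a) has_integral (1 ^ Suc a / real (Suc a) - 0 ^ Suc a / real (Suc a))) {0..1}"
    by (rule fundamental_theorem_of_calculus)
       (auto intro!: derivative_eq_intros simp flip: has_real_derivative_iff_has_vector_derivative
             simp del: of_nat_Suc, cases a, auto simp: field_simps)
  then show ?case by simp
next
  case (Suc b)
  have "((\<lambda>x::real. x ^ a * (1 - x) ^ b - x ^ Suc a * (1 - x) ^ b) has_integral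
      (fact a * fact b / fact (a + b + 1) - fact (Suc a) * fact b / fact (Suc a + b + 1))) {0..1}"
    by (intro has_integral_diff Suc.IH)
  moreover have "(\<lambda>x::real. x ^ a * (1 - x) ^ b - x ^ Suc a * (1 - x) ^ b) =
      (\<lambda>x. x ^ a * (1 - x) ^ Suc b)"
    by (auto simp: algebra_simps)
  moreover have "fact a * fact b / fact (a + b + 1) - fact (Suc a) * fact b / fact (Suc a + b + 1)
      = (fact a * fact (Suc b) / fact (a + Suc b + 1) :: real)"
    by (simp add: divide_simps del: of_nat_Suc) (simp add: algebra_simps)
  ultimately show ?case by simp
qed

text \<open>The Beta integral with exponents \<open>n - l\<close> and \<open>l - 1\<close>, whose
  denominator is \<open>fact n\<close>; the factor \<open>l\<close> turns
  \<open>fact (l - 1)\<close> into \<open>fact l\<close>.\<close>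

lemma has_integral_inverse_binomial:
  assumes "1 \<le> l" "l \<le> n"
  shows "((\<lambda>x::real. real l * (x ^ (n - l) * (1 - x) ^ (l - 1))) has_integral (1 / real (n choose l))) {0..1}"
proof -
  have "real l * fact (l - 1) = fact l"
    using assms by (simp add: fact_reduce)
  then have "real l * (fact (n - l) * fact (l - 1) / fact (n - l + (l - 1) + 1)) = 1 / real (n choose l)"
    using assms by (simp add: binomial_fact field_simps)
  then show ?thesis
    using has_integral_mult_right[OF has_integral_power_mult_one_minus_power, of "real l" "n - l" "l - 1"]
    by simp
qed

theorem corollary2p8:
  fixes l r :: nat
  assumes "1 \<le> l" and "1 \<le> r" and "l \<le> r"
  shows "(\<Sum>i = 0..l - 1. real ((l - 1) choose i) / real ((2 * r - i) choose l))
       = 1 / (2 * real (r choose l))"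
proof -
  \<comment> \<open>\<open>g\<close> is the integrand representing \<open>1 / (r choose l)\<close>,
    and \<open>h\<close> is the closed form of the summed integrands.\<close>
  define g where "g = (\<lambda>u::real. real l * (u ^ (r - l) * (1 - u) ^ (l - 1)))"
  define h where "h = (\<lambda>x::real. real l * (x ^ (2 * (r - l) + 1) * (1 - x\<^sup>2) ^ (l - 1)))"
  have "((\<lambda>x. \<Sum>i = 0..l - 1. real ((l - 1) choose i) *
      (real l * (x ^ (2 * r - i - l) * (1 - x) ^ (l - 1)))) has_integral
      (\<Sum>i = 0..l - 1. real ((l - 1) choose i) * (1 / real ((2 * r - i) choose l)))) {0..1}"
    \<comment> \<open>The integral representation needs \<open>l \<le> 2 * r - i\<close>, which
      follows from \<open>i \<le> l - 1\<close> and \<open>l \<le> r\<close>.\<close>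
    using assms
    by (intro has_integral_sum has_integral_mult_right has_integral_inverse_binomial) auto
  moreover have "(\<Sum>i = 0..l - 1. real ((l - 1) choose i) *
      (real l * (x ^ (2 * r - i - l) * (1 - x) ^ (l - 1)))) = h x" for x
  proof -
    \<comment> \<open>The smallest exponent of \<open>x\<close>, attained at
      \<open>i = l - 1\<close>, is pulled out. The factor \<open>1 ^ i\<close> gives the rest the
      shape of the binomial expansion of \<open>(1 + x) ^ (l - 1)\<close>.\<close>
    have "(\<Sum>i = 0..l - 1. real ((l - 1) choose i) *
        (real l * (x ^ (2 * r - i - l) * (1 - x) ^ (l - 1))))
      = (\<Sum>i\<le>l - 1. real l * x ^ (2 * (r - l) + 1) * (1 - x) ^ (l - 1) *
          (real ((l - 1) choose i) * 1 ^ i * x ^ (l - 1 - i)))"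
    proof (rule sum.cong)
      fix i assume "i \<in> {..l - 1}"
      then have "2 * r - i - l = (2 * (r - l) + 1) + (l - 1 - i)"
        using assms by auto
      then have "x ^ (2 * r - i - l) = x ^ (2 * (r - l) + 1) * x ^ (l - 1 - i)"
        by (simp only: power_add)
      then show "real ((l - 1) choose i) * (real l * (x ^ (2 * r - i - l) * (1 - x) ^ (l - 1)))
        = real l * x ^ (2 * (r - l) + 1) * (1 - x) ^ (l - 1) *
          (real ((l - 1) choose i) * 1 ^ i * x ^ (l - 1 - i))"
        by (simp only: power_one mult_1_right mult_ac)
    qed auto
    also have "\<dots> = real l * x ^ (2 * (r - l) + 1) * (1 - x) ^ (l - 1) * (1 + x) ^ (l - 1)"
      by (simp only: binomial_ring sum_distrib_left)
    also have "\<dots> = real l * x ^ (2 * (r - l) + 1) * ((1 - x) * (1 + x)) ^ (l - 1)"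
      by (simp only: power_mult_distrib mult.assoc)
    also have "(1 - x) * (1 + x) = 1 - x\<^sup>2"
      by (simp add: power2_eq_square algebra_simps)
    finally show ?thesis
      by (simp add: h_def)
  qed
  ultimately have sum: "(h has_integral
      (\<Sum>i = 0..l - 1. real ((l - 1) choose i) / real ((2 * r - i) choose l))) {0..1}"
    by simp
  \<comment> \<open>Substitution \<open>u = x\<^sup>2\<close>, which maps the unit interval into
    itself.\<close>
  have "((\<lambda>x. (2 * x) *\<^sub>R g (x\<^sup>2)) has_integral integral {0\<^sup>2..1\<^sup>2} g) {0..1}"
    by (rule has_integral_substitution[where c = 0 and d = 1])
       (auto simp: g_def power_le_one intro!: continuous_intros derivative_eq_intros)
  moreover have "integral {0\<^sup>2..1\<^sup>2} g = 1 / real (r choose l)"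
    using integral_unique[OF has_integral_inverse_binomial[OF assms(1,3)]]
    by (simp only: g_def power_one zero_power2)
  \<comment> \<open>The odd exponent in \<open>h\<close> leaves exactly one factor \<open>x\<close>
    beside \<open>(x\<^sup>2) ^ (r - l)\<close>, as the derivative \<open>2 * x\<close>
    requires.\<close>
  moreover have "(\<lambda>x. (2 * x) *\<^sub>R g (x\<^sup>2)) = (\<lambda>x. 2 * h x)"
    by (simp add: g_def h_def mult_ac flip: power_mult)
  ultimately have "((\<lambda>x. 2 * h x) has_integral 1 / real (r choose l)) {0..1}"
    by simp
  then have "2 * (\<Sum>i = 0..l - 1. real ((l - 1) choose i) / real ((2 * r - i) choose l))
      = 1 / real (r choose l)"
    using has_integral_mult_right[OF sum, of 2] by (rule has_integral_unique[rotated])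
  then show ?thesis by simp
qed

end
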